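(* Let $(R,\mu)$ be a $\sigma$-finite measure space, let $X$ be a quasi-Banach space, and let $Y\subseteq \mathscr{M}_0(R,\mu)$ be a quasi-Köthe function space whose quasinorm is absolutely continuous and uniformly separating. Let $T\colon X\to Y$ be a bounded positively homogeneous operator. Let $\lambda>0$. If there is a sequence $\{x_j\}_{j=1}^\infty\subseteq B_X$ such that $$\operatorname{supp} Tx_j\to\emptyset\quad\text{as } j\to\infty$$ and $$\|Tx_j\|_Y\ge\lambda\quad\text{for every } j\in\mathbb{N},$$ then $\beta(T\colon X\to Y)\ge\lambda$. In particular, if such a sequence $\{x_j\}_{j=1}^\infty$ exists for every $\lambda\in(0,\|T\|_{X\to Y})$, then $T$ is maximally noncompact, that is, $\beta(T\colon X\to Y)=\|T\|_{X\to Y}$.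
   Context: $\mathscr{M}_0(R,\mu)$ is the set of all $\mu$-measurable functions on $R$ that are finite $\mu$-a.e. (functions equal $\mu$-a.e. are identified). For a measurable function $f$, $\operatorname{supp} f=\{x\in R: f(x)\neq0\}$ (up to a null set). For measurable sets $E_n\subseteq R$, $E_n\to\emptyset$ means that $\chi_{E_n}\to0$ pointwise $\mu$-a.e. Let $Y$ be a quasi-Banach space contained in $\mathscr{M}_0(R,\mu)$ with quasinorm $\|\cdot\|_Y$. - $Y$ is a quasi-Banach lattice if for every $f\in\mathscr{M}_0(R,\mu)$ and $g\in Y$ with $|f|\le|g|$ $\mu$-a.e. one has $f\in Y$ and $\|f\|_Y\le\|g\|_Y$. - A quasi-Banach lattice $Y$ is a quasi-Köthe function space if for every $f\in Y$ and every measurable $E\subseteq R$ with $\mu(E)<\infty$ one has $\chi_E\in Y$ and $f\chi_E\in L^1(R,\mu)$. - The quasinorm of $Y$ is absolutely continuous if $\lim_{n\to\infty}\|f\chi_{E_n}\|_Y=0$ for every $f\in Y$ and every sequence $\{E_n\}_{n=1}^\infty$ of $\mu$-measurable subsets of $R$ with $E_n\to\emptyset$. - The quasinorm of $Y$ is uniformly separating if for every $0<r<s$ there is $\varepsilon_{r,s}>0$ such that $\|f+g\|_Y\ge\varepsilon_{r,s}$ for all $f,g\in Y$ satisfying $\|f\|_Y\ge s>r\ge\|g\|_Y$. $B_X=\{x\in X:\|x\|_X\le1\}$ and $B_Y=\{y\in Y:\|y\|_Y\le 1\}$ are the closed unit balls. An operator (not necessarily linear) $T\colon X\to Y$ is positively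 homogeneous if $\|T(\alpha x)\|_Y=\alpha\|Tx\|_Y$ for every $x\in X$ and every scalar $\alpha>0$; it is bounded if $\|T\|_{X\to Y}=\sup_{x\in B_X}\|Tx\|_Y<\infty$. The ball measure of noncompactness of a bounded positively homogeneous operator $T\colon X\to Y$ is $$\beta(T\colon X\to Y)=\inf\Big\{\varrho>0:\ \text{there are } m\in\mathbb{N}\text{ and } y_1,\dots,y_m\in Y\text{ with } T(B_X)\subseteq\bigcup_{j=1}^m(y_j+\varrho B_Y)\Big\}.$$ The operator $T$ is called maximally noncompact if $\beta(T\colon X\to Y)=\|T\|_{X\to Y}$. *)

theory Defs
  imports "HOL-Analysis.Analysis" "HOL-Library.Function_Algebras"
begin

(* The scalar sort {real_normed_field, euclidean_space} has the instances real and complex.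
   By the Frobenius theorem there are no other such fields up to isomorphism, so it stands
   for "real or complex scalars". *)

(* A quasi-Banach space whose elements are the cosets x + Z with x in X; the quasinorm N is
   given on representatives and is constant on cosets. Z = {0} gives an ordinary
   quasi-Banach space; Z = null functions gives spaces of functions identified almost
   everywhere. *)
locale quasi_banach_space = vector_space scale
  for scale :: "'k::{real_normed_field, euclidean_space} \<Rightarrow> 'v::ab_group_add \<Rightarrow> 'v" +
  fixes X Z :: "'v set" and N :: "'v \<Rightarrow> real"
  assumes subspace_X: "subspace X"
    and subspace_Z: "subspace Z"
    and Z_subset: "Z \<subseteq> X"
    and N_cong: "\<lbrakk>x \<in> X; y \<in> X; x - y \<in> Z\<rbrakk> \<Longrightarrow> N x = N y"
    and N_nonneg: "x \<in> X \<Longrightarrow> 0 \<le> N x"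
    and N_eq_0_iff: "x \<in> X \<Longrightarrow> N x = 0 \<longleftrightarrow> x \<in> Z"
    and N_scale: "x \<in> X \<Longrightarrow> N (scale c x) = norm c * N x"
    and N_quasi_triangle: "\<exists>C\<ge>1. \<forall>x\<in>X. \<forall>y\<in>X. N (x + y) \<le> C * (N x + N y)"
    and complete_N:
      "\<lbrakk>\<forall>n. u n \<in> X; \<forall>e>0. \<exists>n0. \<forall>m\<ge>n0. \<forall>n\<ge>n0. N (u m - u n) < e\<rbrakk>
        \<Longrightarrow> \<exists>x\<in>X. (\<lambda>n. N (u n - x)) \<longlonglongrightarrow> 0"

definition fscale :: "'k::field \<Rightarrow> ('a \<Rightarrow> 'k) \<Rightarrow> 'a \<Rightarrow> 'k" where
  "fscale c f = (\<lambda>x. c * f x)"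

definition null_functions :: "'a measure \<Rightarrow> ('a \<Rightarrow> 'k::{real_normed_field, euclidean_space}) set" where
  "null_functions M = {f \<in> borel_measurable M. AE x in M. f x = 0}"

(* borel_measurable M modulo null_functions M is the space of almost everywhere finite
   measurable functions: each class has an everywhere finite representative. *)
locale quasi_banach_function_space =
  quasi_banach_space fscale Y "null_functions M" N
  for M :: "'a measure" and Y :: "('a \<Rightarrow> 'k::{real_normed_field, euclidean_space}) set"
    and N :: "('a \<Rightarrow> 'k) \<Rightarrow> real" +
  assumes Y_measurable: "Y \<subseteq> borel_measurable M"

locale quasi_banach_lattice = quasi_banach_function_space M Y N
  for M :: "'a measure" and Y :: "('a \<Rightarrow> 'k::{real_normed_field, euclidean_space}) set"
    and N :: "('a \<Rightarrow> 'k) \<Rightarrow> real" +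
  assumes lattice:
    "\<lbrakk>f \<in> borel_measurable M; g \<in> Y; AE x in M. norm (f x) \<le> norm (g x)\<rbrakk>
      \<Longrightarrow> f \<in> Y \<and> N f \<le> N g"

locale quasi_koethe_space = quasi_banach_lattice M Y N
  for M :: "'a measure" and Y :: "('a \<Rightarrow> 'k::{real_normed_field, euclidean_space}) set"
    and N :: "('a \<Rightarrow> 'k) \<Rightarrow> real" +
  assumes koethe:
    "\<lbrakk>f \<in> Y; E \<in> sets M; emeasure M E < \<infinity>\<rbrakk>
      \<Longrightarrow> indicator E \<in> Y \<and> integrable M (\<lambda>x. f x * indicator E x)"

definition support :: "'a measure \<Rightarrow> ('a \<Rightarrow> 'k::zero) \<Rightarrow> 'a set" where
  "support M f = {x \<in> space M. f x \<noteq> 0}"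

definition tends_to_empty :: "'a measure \<Rightarrow> (nat \<Rightarrow> 'a set) \<Rightarrow> bool" where
  "tends_to_empty M E \<longleftrightarrow> (AE x in M. (\<lambda>n. indicator (E n) x :: real) \<longlonglongrightarrow> 0)"

definition abs_continuous_quasinorm ::
  "'a measure \<Rightarrow> ('a \<Rightarrow> 'k::{real_normed_field, euclidean_space}) set \<Rightarrow> (('a \<Rightarrow> 'k) \<Rightarrow> real) \<Rightarrow> bool" where
  "abs_continuous_quasinorm M Y N \<longleftrightarrow>
    (\<forall>f\<in>Y. \<forall>E. (\<forall>n. E n \<in> sets M) \<longrightarrow> tends_to_empty M E \<longrightarrow>
      (\<lambda>n. N (\<lambda>x. f x * indicator (E n) x)) \<longlonglongrightarrow> 0)"

definition uniformly_separating :: "'v::ab_group_add set \<Rightarrow> ('v \<Rightarrow> real) \<Rightarrow> bool" where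
  "uniformly_separating Y N \<longleftrightarrow>
    (\<forall>r s. 0 < r \<longrightarrow> r < s \<longrightarrow>
      (\<exists>\<epsilon>>0. \<forall>f\<in>Y. \<forall>g\<in>Y. N f \<ge> s \<longrightarrow> r \<ge> N g \<longrightarrow> N (f + g) \<ge> \<epsilon>))"

definition unit_ball :: "'v set \<Rightarrow> ('v \<Rightarrow> real) \<Rightarrow> 'v set" where
  "unit_ball X N = {x \<in> X. N x \<le> 1}"

definition positively_homogeneous ::
  "('k::real_normed_field \<Rightarrow> 'x \<Rightarrow> 'x) \<Rightarrow> 'x set \<Rightarrow> ('y \<Rightarrow> real) \<Rightarrow> ('x \<Rightarrow> 'y) \<Rightarrow> bool" where
  "positively_homogeneous scaleX X NY T \<longleftrightarrow>
    (\<forall>x\<in>X. \<forall>\<alpha>::real. \<alpha> > 0 \<longrightarrow> NY (T (scaleX (of_real \<alpha>) x)) = \<alpha> * NY (T x))"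

definition bounded_operator ::
  "'x set \<Rightarrow> ('x \<Rightarrow> real) \<Rightarrow> ('y \<Rightarrow> real) \<Rightarrow> ('x \<Rightarrow> 'y) \<Rightarrow> bool" where
  "bounded_operator X NX NY T \<longleftrightarrow> bdd_above ((\<lambda>x. NY (T x)) ` unit_ball X NX)"

(* operator_norm and ball_noncompactness are a real supremum and a real infimum; they have the
   intended meaning for bounded operators only. *)
definition operator_norm ::
  "'x set \<Rightarrow> ('x \<Rightarrow> real) \<Rightarrow> ('y \<Rightarrow> real) \<Rightarrow> ('x \<Rightarrow> 'y) \<Rightarrow> real" where
  "operator_norm X NX NY T = (SUP x\<in>unit_ball X NX. NY (T x))"

definition ball_noncompactness ::
  "'x set \<Rightarrow> ('x \<Rightarrow> real) \<Rightarrow> ('k::real_normed_field \<Rightarrow> 'y \<Rightarrow> 'y) \<Rightarrow> 'y::ab_group_add set \<Rightarrow>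
    ('y \<Rightarrow> real) \<Rightarrow> ('x \<Rightarrow> 'y) \<Rightarrow> real" where
  "ball_noncompactness X NX scaleY Y NY T =
    Inf {\<rho>. \<rho> > 0 \<and> (\<exists>(m::nat) y. (\<forall>j\<in>{1..m}. y j \<in> Y) \<and>
      T ` unit_ball X NX \<subseteq> (\<Union>j\<in>{1..m}. (\<lambda>b. y j + scaleY (of_real \<rho>) b) ` unit_ball Y NY))}"

definition maximally_noncompact ::
  "'x set \<Rightarrow> ('x \<Rightarrow> real) \<Rightarrow> ('k::real_normed_field \<Rightarrow> 'y \<Rightarrow> 'y) \<Rightarrow> 'y::ab_group_add set \<Rightarrow>
    ('y \<Rightarrow> real) \<Rightarrow> ('x \<Rightarrow> 'y) \<Rightarrow> bool" where
  "maximally_noncompact X NX scaleY Y NY T \<longleftrightarrow>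
    ball_noncompactness X NX scaleY Y NY T = operator_norm X NX NY T"

end

theory Submission imports Defs begin

text \<open>
  If finitely many balls of radius \<open>\<rho> < \<lambda>\<close> with centres \<open>y\<^sub>k\<close> cover the image of the unit ball,
  absolute continuity gives an index \<open>j\<close> for which every \<open>y\<^sub>k \<chi>\<^sub>E\<close> with \<open>E = supp Tx\<^sub>j\<close> is as small as
  we like. But \<open>Tx\<^sub>j = y\<^sub>k + \<rho>b\<close> for some \<open>k\<close> and some \<open>b\<close> in the unit ball, so
  \<open>y\<^sub>k \<chi>\<^sub>E = Tx\<^sub>j - \<rho>b\<chi>\<^sub>E\<close>, the sum of a function of quasinorm at least \<open>\<lambda>\<close> and one of
  quasinorm at most \<open>\<rho>\<close>; uniform separation bounds it away from zero.
\<close>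

text \<open>The set under the infimum in \<open>ball_noncompactness\<close>. It gets a name because
  a real \<open>Inf\<close> can be handled only once nonemptiness and a lower bound are
  known.\<close>

definition finite_cover_radii ::
  "'x set \<Rightarrow> ('x \<Rightarrow> real) \<Rightarrow> ('k::real_normed_field \<Rightarrow> 'y \<Rightarrow> 'y) \<Rightarrow> 'y::ab_group_add set \<Rightarrow>
    ('y \<Rightarrow> real) \<Rightarrow> ('x \<Rightarrow> 'y) \<Rightarrow> real set" where
  "finite_cover_radii X NX scaleY Y NY T =
    {\<rho>. \<rho> > 0 \<and> (\<exists>(m::nat) y. (\<forall>j\<in>{1..m}. y j \<in> Y) \<and>
      T ` unit_ball X NX \<subseteq> (\<Union>j\<in>{1..m}. (\<lambda>b. y j + scaleY (of_real \<rho>) b) ` unit_ball Y NY))}"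

lemma ball_noncompactness_eq_Inf:
  "ball_noncompactness X NX scaleY Y NY T = Inf (finite_cover_radii X NX scaleY Y NY T)"
  by (simp add: ball_noncompactness_def finite_cover_radii_def)

lemma bdd_below_finite_cover_radii: "bdd_below (finite_cover_radii X NX scaleY Y NY T)"
  by (rule bdd_belowI[of _ 0]) (auto simp: finite_cover_radii_def)

context quasi_banach_space
begin

lemma zero_mem_unit_ball: "0 \<in> unit_ball X N"
  using subspace_0[OF subspace_X] subspace_0[OF subspace_Z] N_eq_0_iff
  by (force simp: unit_ball_def)

lemma norm_le_operator_norm:
  assumes "bounded_operator A NA N T" "x \<in> unit_ball A NA"
  shows "N (T x) \<le> operator_norm A NA N T"
  using assms unfolding bounded_operator_def operator_norm_def by (rule cSUP_upper[rotated])

text \<open>A single ball centred at 0 covers the image: \<open>T x\<close> is \<open>r\<close>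
  times a vector of quasinorm at most 1. The locale's \<open>X\<close> and \<open>N\<close> are the
  target of \<open>T\<close> here and below; \<open>A\<close> and \<open>NA\<close> stand for the
  domain.\<close>

lemma finite_cover_radiiI:
  assumes T: "T ` A \<subseteq> X" and bdd: "bounded_operator A NA N T"
    and r: "0 < r" "operator_norm A NA N T \<le> r"
  shows "r \<in> finite_cover_radii A NA scale X N T"
proof -
  have "T x \<in> (\<lambda>b. 0 + scale (of_real r) b) ` unit_ball X N" if x: "x \<in> unit_ball A NA" for x
  proof (rule image_eqI)
    have TX: "T x \<in> X" using T x by (auto simp: unit_ball_def)
    show "T x = 0 + scale (of_real r) (scale (of_real (inverse r)) (T x))"
      using r by simp
    show "scale (of_real (inverse r)) (T x) \<in> unit_ball X N"
      using norm_le_operator_norm[OF bdd x] r subspace_scale[OF subspace_X TX]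
      by (simp add: unit_ball_def N_scale[OF TX] field_simps norm_divide)
  qed
  then have "T ` unit_ball A NA \<subseteq>
      (\<Union>j\<in>{1..1::nat}. (\<lambda>b. 0 + scale (of_real r) b) ` unit_ball X N)"
    by auto
  moreover have "\<forall>j\<in>{1..1::nat}. 0 \<in> X"
    using subspace_0[OF subspace_X] by simp
  ultimately show ?thesis
    using r(1) unfolding finite_cover_radii_def mem_Collect_eq
    by (intro conjI exI[of _ "1::nat"] exI[of _ "\<lambda>_. 0"])
qed

lemma operator_norm_nonneg:
  assumes "T ` A \<subseteq> X" "bounded_operator A NA N T" "unit_ball A NA \<noteq> {}"
  shows "0 \<le> operator_norm A NA N T"
proof -
  obtain x where x: "x \<in> unit_ball A NA" using assms(3) by auto
  then have "0 \<le> N (T x)" using assms(1) N_nonneg by (auto simp: unit_ball_def)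
  also have "\<dots> \<le> operator_norm A NA N T" using assms(2) x by (rule norm_le_operator_norm)
  finally show ?thesis .
qed

lemma finite_cover_radii_nonempty:
  assumes "T ` A \<subseteq> X" "bounded_operator A NA N T"
  shows "finite_cover_radii A NA scale X N T \<noteq> {}"
proof -
  \<comment> \<open>The maximum with 1 keeps the radius positive when the operator norm is
    0.\<close>
  have "max 1 (operator_norm A NA N T) \<in> finite_cover_radii A NA scale X N T"
    by (intro finite_cover_radiiI assms) auto
  then show ?thesis by blast
qed

lemma ball_noncompactness_nonneg:
  assumes "T ` A \<subseteq> X" "bounded_operator A NA N T"
  shows "0 \<le> ball_noncompactness A NA scale X N T"
  unfolding ball_noncompactness_eq_Inf
  by (rule cInf_greatest[OF finite_cover_radii_nonempty[OF assms]])
    (auto simp: finite_cover_radii_def)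

text \<open>Every radius strictly above the operator norm is admissible. The slack \<open>e\<close>
  is there because admissible radii are positive, while the operator norm may be 0.\<close>

lemma ball_noncompactness_le_operator_norm:
  assumes "T ` A \<subseteq> X" "bounded_operator A NA N T" "unit_ball A NA \<noteq> {}"
  shows "ball_noncompactness A NA scale X N T \<le> operator_norm A NA N T"
proof (rule field_le_epsilon)
  fix e :: real assume "0 < e"
  then have "operator_norm A NA N T + e \<in> finite_cover_radii A NA scale X N T"
    using operator_norm_nonneg[OF assms] by (intro finite_cover_radiiI assms) auto
  then show "ball_noncompactness A NA scale X N T \<le> operator_norm A NA N T + e"
    unfolding ball_noncompactness_eq_Inf by (intro cInf_lower bdd_below_finite_cover_radii)
qed

end

lemma (in quasi_banach_function_space) support_sets:
  assumes "f \<in> Y" shows "support M f \<in> sets M"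
proof -
  have [measurable]: "f \<in> borel_measurable M" using assms Y_measurable by auto
  show ?thesis unfolding support_def by measurable
qed

lemma (in quasi_banach_lattice) mult_indicator:
  assumes f: "f \<in> Y" and [measurable]: "E \<in> sets M"
  shows "(\<lambda>x. f x * indicator E x) \<in> Y" "N (\<lambda>x. f x * indicator E x) \<le> N f"
proof -
  have [measurable]: "f \<in> borel_measurable M" using f Y_measurable by auto
  have "(\<lambda>x. f x * indicator E x) \<in> borel_measurable M" by measurable
  moreover have "AE x in M. norm (f x * indicator E x) \<le> norm (f x)"
    by (auto simp: indicator_def)
  ultimately show "(\<lambda>x. f x * indicator E x) \<in> Y" "N (\<lambda>x. f x * indicator E x) \<le> N f"
    using lattice[OF _ f] by auto
qed

text \<open>Multiplying \<open>eq\<close> by the indicator of the support of \<open>f\<close> leaves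
  \<open>f\<close> unchanged on \<open>space M\<close> and cuts down only \<open>y\<close> and
  \<open>b\<close>. Uniform separation enters as \<open>sep\<close>, with \<open>e\<close> already
  fixed, because \<open>e\<close> has to be chosen before \<open>f\<close> is known.\<close>

lemma (in quasi_banach_lattice) center_restricted_to_support_ge:
  assumes sep: "\<And>f g. \<lbrakk>f \<in> Y; g \<in> Y; l \<le> N f; N g \<le> r\<rbrakk> \<Longrightarrow> e \<le> N (f + g)"
    and f: "f \<in> Y" "l \<le> N f" and y: "y \<in> Y" and b: "b \<in> unit_ball Y N" and "0 < r"
    and eq: "f = y + fscale (of_real r) b"
  shows "e \<le> N (\<lambda>x. y x * indicator (support M f) x)"
proof -
  let ?E = "support M f"
  let ?y = "\<lambda>x. y x * indicator ?E x"
  let ?g = "fscale (- of_real r) (\<lambda>x. b x * indicator ?E x)"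
  have E: "?E \<in> sets M" using support_sets[OF f(1)] .
  have b': "b \<in> Y" "N b \<le> 1" using b by (auto simp: unit_ball_def)
  have bE: "(\<lambda>x. b x * indicator ?E x) \<in> Y" "N (\<lambda>x. b x * indicator ?E x) \<le> 1"
    using mult_indicator[OF b'(1) E] b'(2) by auto
  have g: "?g \<in> Y" using subspace_scale[OF subspace_X bE(1)] .
  have "N ?g \<le> r" using bE(2) \<open>0 < r\<close> N_scale[OF bE(1), of "- of_real r"] by simp
  then have "e \<le> N (f + ?g)" using sep f g by blast
  \<comment> \<open>The two functions agree on \<open>space M\<close>, but
    \<open>support M f\<close> lies inside \<open>space M\<close> and \<open>f\<close> need not
    vanish outside it. So they are compared modulo null functions, not by equality.\<close>
  also have "N (f + ?g) = N ?y"
  proof (rule N_cong)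
    show fg: "f + ?g \<in> Y" using subspace_add[OF subspace_X f(1) g] .
    show yE: "?y \<in> Y" using mult_indicator[OF y E] by simp
    have "f + ?g - ?y \<in> borel_measurable M"
      using subspace_diff[OF subspace_X fg yE] Y_measurable by auto
    moreover have "AE x in M. (f + ?g - ?y) x = 0"
    proof (rule AE_I2)
      fix x assume x: "x \<in> space M"
      have fx: "f x = y x + of_real r * b x" unfolding eq by (simp add: fscale_def)
      show "(f + ?g - ?y) x = 0"
      proof (cases "x \<in> ?E")
        case True
        then show ?thesis using fx by (simp add: fscale_def)
      next
        case False
        moreover have "f x = 0" using x False by (simp add: support_def)
        ultimately show ?thesis by (simp add: fscale_def)
      qed
    qed
    ultimately show "f + ?g - ?y \<in> null_functions M" by (simp add: null_functions_def)
  qed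
  finally show ?thesis .
qed

lemma (in quasi_banach_lattice) ball_noncompactness_ge:
  assumes ac: "abs_continuous_quasinorm M Y N" and sep: "uniformly_separating Y N"
    and T: "T ` A \<subseteq> Y" and bdd: "bounded_operator A NA N T" and "0 < l"
    and x: "\<And>j. x j \<in> unit_ball A NA"
    and supp: "tends_to_empty M (\<lambda>j. support M (T (x j)))"
    and ge: "\<And>j. l \<le> N (T (x j))"
  shows "l \<le> ball_noncompactness A NA fscale Y N T"
  unfolding ball_noncompactness_eq_Inf
proof (rule cInf_greatest[OF finite_cover_radii_nonempty[OF T bdd]])
  fix r assume "r \<in> finite_cover_radii A NA fscale Y N T"
  then obtain m :: nat and y where r: "0 < r" and y: "\<And>k. k \<in> {1..m} \<Longrightarrow> y k \<in> Y"
    and cover: "T ` unit_ball A NA \<subseteq>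
      (\<Union>k\<in>{1..m}. (\<lambda>b. y k + fscale (of_real r) b) ` unit_ball Y N)"
    unfolding finite_cover_radii_def by blast
  show "l \<le> r"
  proof (rule ccontr)
    assume "\<not> l \<le> r"
    then have "r < l" by simp
    \<comment> \<open>The separation constant depends on \<open>r\<close> and \<open>l\<close>
      alone, so it may be used to select the index \<open>j\<close> below.\<close>
    then obtain e where "0 < e"
      and e: "\<And>f g. \<lbrakk>f \<in> Y; g \<in> Y; l \<le> N f; N g \<le> r\<rbrakk> \<Longrightarrow> e \<le> N (f + g)"
      using sep r unfolding uniformly_separating_def by meson
    have TY: "T (x j) \<in> Y" for j using T x by (auto simp: unit_ball_def)
    have "\<forall>\<^sub>F j in sequentially. N (\<lambda>t. y k t * indicator (support M (T (x j))) t) < e"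
      if "k \<in> {1..m}" for k
    proof (rule order_tendstoD(2)[OF _ \<open>0 < e\<close>])
      show "(\<lambda>j. N (\<lambda>t. y k t * indicator (support M (T (x j))) t)) \<longlonglongrightarrow> 0"
        using ac[unfolded abs_continuous_quasinorm_def, rule_format, OF y[OF that] _ supp]
          support_sets[OF TY] by simp
    qed
    \<comment> \<open>The centre whose ball contains \<open>T (x j)\<close> is known only after
      \<open>j\<close> is chosen, so \<open>j\<close> must serve all centres at once; this is where
      their finiteness matters.\<close>
    then have "\<forall>\<^sub>F j in sequentially.
        \<forall>k\<in>{1..m}. N (\<lambda>t. y k t * indicator (support M (T (x j))) t) < e"
      by (intro eventually_ball_finite) auto
    from eventually_happens'[OF sequentially_bot this]
    obtain j where j: "\<forall>k\<in>{1..m}. N (\<lambda>t. y k t * indicator (support M (T (x j))) t) < e" ..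
    have "T (x j) \<in> T ` unit_ball A NA" using x by blast
    then obtain k b where kb: "k \<in> {1..m}" "b \<in> unit_ball Y N"
      "T (x j) = y k + fscale (of_real r) b"
      using cover by blast
    have "e \<le> N (\<lambda>t. y k t * indicator (support M (T (x j))) t)"
      using e TY ge y[OF kb(1)] kb(2) r kb(3) by (rule center_restricted_to_support_ge)
    with bspec[OF j kb(1)] show False by simp
  qed
qed


theorem theorem3p1:
  fixes M :: "'a measure"
    and scaleX :: "'k::{real_normed_field, euclidean_space} \<Rightarrow> 'x::ab_group_add \<Rightarrow> 'x"
    and X :: "'x set" and NX :: "'x \<Rightarrow> real"
    and Y :: "('a \<Rightarrow> 'k) set" and NY :: "('a \<Rightarrow> 'k) \<Rightarrow> real"
    and T :: "'x \<Rightarrow> 'a \<Rightarrow> 'k"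
  assumes "sigma_finite_measure M"
    and "quasi_banach_space scaleX X {0} NX"
    and "quasi_koethe_space M Y NY"
    and "abs_continuous_quasinorm M Y NY"
    and "uniformly_separating Y NY"
    and "T ` X \<subseteq> Y"
    and "positively_homogeneous scaleX X NY T"
    and "bounded_operator X NX NY T"
  shows "(\<forall>l>0. (\<exists>x :: nat \<Rightarrow> 'x. (\<forall>j. x j \<in> unit_ball X NX) \<and>
                tends_to_empty M (\<lambda>j. support M (T (x j))) \<and>
                (\<forall>j. NY (T (x j)) \<ge> l))
            \<longrightarrow> ball_noncompactness X NX fscale Y NY T \<ge> l)
      \<and> ((\<forall>l. 0 < l \<and> l < operator_norm X NX NY T \<longrightarrow>
             (\<exists>x :: nat \<Rightarrow> 'x. (\<forall>j. x j \<in> unit_ball X NX) \<and>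
                tends_to_empty M (\<lambda>j. support M (T (x j))) \<and>
                (\<forall>j. NY (T (x j)) \<ge> l)))
            \<longrightarrow> maximally_noncompact X NX fscale Y NY T)"
proof -
  interpret X: quasi_banach_space scaleX X "{0}" NX by fact
  interpret Y: quasi_koethe_space M Y NY by fact
  note T = \<open>T ` X \<subseteq> Y\<close> \<open>bounded_operator X NX NY T\<close>
  let ?seq = "\<lambda>l (x :: nat \<Rightarrow> 'x). (\<forall>j. x j \<in> unit_ball X NX) \<and>
    tends_to_empty M (\<lambda>j. support M (T (x j))) \<and> (\<forall>j. NY (T (x j)) \<ge> l)"
  have lower: "l \<le> ball_noncompactness X NX fscale Y NY T" if "0 < l" "\<exists>x. ?seq l x" for l
  proof -
    from that(2) obtain x where "?seq l x" ..
    with \<open>0 < l\<close> show ?thesis by (intro Y.ball_noncompactness_ge[OF assms(4,5) T, of l x]) auto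
  qed
  have "maximally_noncompact X NX fscale Y NY T"
    if ex: "\<forall>l. 0 < l \<and> l < operator_norm X NX NY T \<longrightarrow> (\<exists>x. ?seq l x)"
    unfolding maximally_noncompact_def
  proof (rule antisym)
    \<comment> \<open>Since 0 lies in the unit ball of \<open>X\<close>, the supremum defining the
      operator norm is over a nonempty set.\<close>
    show "ball_noncompactness X NX fscale Y NY T \<le> operator_norm X NX NY T"
      using Y.ball_noncompactness_le_operator_norm[OF T] X.zero_mem_unit_ball by blast
    \<comment> \<open>It suffices to bound every \<open>l\<close> below the operator norm. The
      sequences are given for positive \<open>l\<close> only; for the other \<open>l\<close> the
      nonnegativity of the measure of noncompactness is enough.\<close>
    show "operator_norm X NX NY T \<le> ball_noncompactness X NX fscale Y NY T"
    proof (rule dense_le)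
      fix l assume l: "l < operator_norm X NX NY T"
      show "l \<le> ball_noncompactness X NX fscale Y NY T"
      proof (cases "0 < l")
        case True
        with ex l have "\<exists>x. ?seq l x" by simp
        with True show ?thesis by (rule lower)
      next
        case False
        then show ?thesis using Y.ball_noncompactness_nonneg[OF T] by linarith
      qed
    qed
  qed
  with lower show ?thesis by simp
qed

end
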